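(* Let $n\geq 1$, $m\geq 1$ and $k_f\geq 0$ be integers, and put $k=2k_f$ and $v=k_f^2+1$. If \[ k^2\cdot v\cdot \lg(n+1) \;+\; k\cdot v\cdot \lg m \;+\; v\cdot(1+\lg v) \;\leq\; n, \] then the problem $\mathit{Disj}_n$ cannot be solved by any mp2s-automaton with parameters $(\mathbb{D}_n,m,k_f,0)$ (i.e., with $m$ states, $k_f$ forward heads and no backward heads on each of the two input streams). Here $\lg$ denotes the logarithm to base 2.
   Context: Let $\mathbb{D}$ be a set and let $m,k_f,k_b$ be integers with $m\geq 1$ and $k_f,k_b\geq 0$. An mp2s-automaton with parameters $(\mathbb{D},m,k_f,k_b)$ receives as input two finite strings (streams) $S=s_1\cdots s_{|S|}\in\mathbb{D}^*$ and $T=t_1\cdots t_{|T|}\in\mathbb{D}^*$. It has a finite state set $Q$ with $|Q|=m$, a designated start state, and a set $F\subseteq Q$ of accepting states. On each of the two streams it has $k_f$ forward heads and $k_b$ backward heads; $k=2k_f+2k_b$ is the total number of heads. Initially the automaton is in the start state, all forward heads on $S$ (resp. $T$) are on $s_1$ (resp. $t_1$), and all backward heads on $S$ (resp. $T$) are on $s_{|S|}$ (resp. $t_{|T|}$). A deterministic transition function $\delta: Q\times(\mathbb{D}\cup\{\mathit{end}\})^k\to Q\times\{\mathit{advance},\mathit{stay}\}^k$ maps the current state and the symbols under the $k$ heads to the next state and, for each head, whether it is advanced (forward heads move one position right, backward heads one position left) or stays; the symbol $\mathit{end}\notin\mathbb{D}$ is read by a head that has moved beyond the end of its stream. Heads move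 asynchronously. The computation ends as soon as every head has passed its entire stream; the input is accepted iff the state at that moment is in $F$. For an integer $n\geq 1$, let $\mathbb{D}_n=\{a_1,b_1,\ldots,a_n,b_n\}$ be a fixed set of $2n$ distinct data items. The problem $\mathit{Disj}_n$: given streams $S,T$ over $\mathbb{D}_n$ with $|S|=|T|=n$, decide whether the sets $\{s_1,\ldots,s_n\}$ and $\{t_1,\ldots,t_n\}$ are disjoint. An mp2s-automaton solves $\mathit{Disj}_n$ if for all $S,T\in\mathbb{D}_n^*$ with $|S|=|T|=n$ it accepts $(S,T)$ if and only if these two sets are disjoint. *)

theory Defs
  imports Complex_Main "HOL-Library.FuncSet"
begin

datatype stream_id = StreamS | StreamT

datatype head = Forward stream_id nat | Backward stream_id nat

datatype move = Advance | Stay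

fun head_stream :: "head \<Rightarrow> stream_id" where
  "head_stream (Forward s i) = s"
| "head_stream (Backward s i) = s"

definition heads :: "nat \<Rightarrow> nat \<Rightarrow> head set" where
  "heads kf kb = {Forward s i | s i. i < kf} \<union> {Backward s i | s i. i < kb}"

text \<open>
  A symbol vector is an extensional function on the set of heads, so the transition
  function sees exactly the \<open>2 * kf + 2 * kb\<close> symbols under the heads.
  The symbol \<^emph>\<open>end\<close> is \<^const>\<open>None\<close>; a data item \<open>d\<close> is \<open>Some d\<close>.
\<close>

record ('q, 'd) mp2s =
  states :: "'q set"
  start :: 'q
  accepting :: "'q set"
  trans_fun :: "'q \<times> (head \<Rightarrow> 'd option) \<Rightarrow> 'q \<times> (head \<Rightarrow> move)"

definition mp2s_automaton ::
  "'d set \<Rightarrow> nat \<Rightarrow> nat \<Rightarrow> nat \<Rightarrow> ('q, 'd) mp2s \<Rightarrow> bool" where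
  "mp2s_automaton D m kf kb A \<longleftrightarrow>
     finite (states A) \<and> card (states A) = m \<and>
     start A \<in> states A \<and> accepting A \<subseteq> states A \<and>
     trans_fun A \<in> states A \<times> (heads kf kb \<rightarrow>\<^sub>E insert None (Some ` D))
                    \<rightarrow> states A \<times> (heads kf kb \<rightarrow>\<^sub>E UNIV)"

fun stream_of :: "'d list \<Rightarrow> 'd list \<Rightarrow> stream_id \<Rightarrow> 'd list" where
  "stream_of S T StreamS = S"
| "stream_of S T StreamT = T"

text \<open>
  The position of a head is the number of symbols of its stream that it has already passed,
  a number between \<open>0\<close> and the length of the stream. A forward head at position
  \<open>p\<close> is on the item with (0-based) index \<open>p\<close>, a backward head on the one with index
  \<open>length w - 1 - p\<close>, and a head at position \<open>length w\<close> has passed the whole stream.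
  A head that has passed its stream remains there when advanced.
\<close>

fun head_symbol :: "'d list \<Rightarrow> 'd list \<Rightarrow> head \<Rightarrow> nat \<Rightarrow> 'd option" where
  "head_symbol S T (Forward s i) p =
     (let w = stream_of S T s in if p < length w then Some (w ! p) else None)"
| "head_symbol S T (Backward s i) p =
     (let w = stream_of S T s in if p < length w then Some (w ! (length w - 1 - p)) else None)"

type_synonym 'q config = "'q \<times> (head \<Rightarrow> nat)"

definition initial_config :: "nat \<Rightarrow> nat \<Rightarrow> ('q, 'd) mp2s \<Rightarrow> 'q config" where
  "initial_config kf kb A = (start A, \<lambda>h\<in>heads kf kb. 0)"

definition step ::
  "nat \<Rightarrow> nat \<Rightarrow> ('q, 'd) mp2s \<Rightarrow> 'd list \<Rightarrow> 'd list \<Rightarrow> 'q config \<Rightarrow> 'q config" where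
  "step kf kb A S T = (\<lambda>(q, pos).
     let (q', mv) = trans_fun A (q, \<lambda>h\<in>heads kf kb. head_symbol S T h (pos h))
     in (q', \<lambda>h\<in>heads kf kb.
               case mv h of
                 Advance \<Rightarrow> min (pos h + 1) (length (stream_of S T (head_stream h)))
               | Stay \<Rightarrow> pos h))"

definition config_at ::
  "nat \<Rightarrow> nat \<Rightarrow> ('q, 'd) mp2s \<Rightarrow> 'd list \<Rightarrow> 'd list \<Rightarrow> nat \<Rightarrow> 'q config" where
  "config_at kf kb A S T t = (step kf kb A S T ^^ t) (initial_config kf kb A)"

definition all_passed :: "nat \<Rightarrow> nat \<Rightarrow> 'd list \<Rightarrow> 'd list \<Rightarrow> 'q config \<Rightarrow> bool" where
  "all_passed kf kb S T c \<longleftrightarrow>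
     (\<forall>h\<in>heads kf kb. snd c h = length (stream_of S T (head_stream h)))"

text \<open>
  The state that counts is the one at the first time at which every head has passed its
  stream; an input on which this never happens is not accepted.
\<close>

definition accepts ::
  "nat \<Rightarrow> nat \<Rightarrow> ('q, 'd) mp2s \<Rightarrow> 'd list \<Rightarrow> 'd list \<Rightarrow> bool" where
  "accepts kf kb A S T \<longleftrightarrow>
     (\<exists>t. all_passed kf kb S T (config_at kf kb A S T t) \<and>
          (\<forall>t'<t. \<not> all_passed kf kb S T (config_at kf kb A S T t')) \<and>
          fst (config_at kf kb A S T t) \<in> accepting A)"

datatype item = ItemA nat | ItemB nat

definition data_items :: "nat \<Rightarrow> item set" where
  "data_items n = ItemA ` {1..n} \<union> ItemB ` {1..n}"

definition solves_Disj :: "nat \<Rightarrow> nat \<Rightarrow> nat \<Rightarrow> ('q, item) mp2s \<Rightarrow> bool" where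
  "solves_Disj n kf kb A \<longleftrightarrow>
     (\<forall>S T. set S \<subseteq> data_items n \<and> set T \<subseteq> data_items n \<and> length S = n \<and> length T = n \<longrightarrow>
        (accepts kf kb A S T \<longleftrightarrow> set S \<inter> set T = {}))"

end

theory Submission
  imports Defs
begin

text \<open>
  For \<open>I \<subseteq> {..<n}\<close> the first stream lists \<open>a_i\<close> (if \<open>i \<in> I\<close>) or \<open>b_i\<close> for
  increasing \<open>i\<close>; the second lists the other item of each pair, but with \<open>v = kf\<^sup>2 + 1\<close> blocks
  of \<open>L = n div v\<close> consecutive indices in reverse order. A forward head on the first stream
  and one on the second can be in the same block simultaneously for at most one block, so some
  block is never compared by any of the \<open>kf\<^sup>2\<close> pairs of heads. By the pigeonhole principle there are
  two distinct \<open>I\<close>, \<open>J\<close> with the same uncompared block that agree outside of this block and for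
  which the configurations in which the heads leave the block coincide. On the first stream of
  \<open>I\<close> and the second stream of \<open>J\<close> the automaton follows the run of \<open>I\<close> while heads of the
  first stream are in the block and the run of \<open>J\<close> while heads of the second stream are, and
  whenever the block becomes empty the two runs meet again. So it accepts two streams that share
  an item.
\<close>

section \<open>Single steps and monotonicity of head positions\<close>

lemma step_cong:
  assumes "\<And>h. h \<in> heads kf kb \<Longrightarrow> head_symbol S T h (snd c h) = head_symbol S' T' h (snd c h)"
    and "length S = length S'" and "length T = length T'"
  shows "step kf kb A S T c = step kf kb A S' T' c"
proof -
  have sym: "(\<lambda>h\<in>heads kf kb. head_symbol S T h (snd c h)) =
      (\<lambda>h\<in>heads kf kb. head_symbol S' T' h (snd c h))"
    using assms(1) by (auto intro!: restrict_ext)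
  have len: "length (stream_of S T s) = length (stream_of S' T' s)" for s
    using assms(2,3) by (cases s) auto
  show ?thesis
    using sym by (cases c) (auto simp: step_def len split: prod.split move.split intro!: restrict_ext)
qed

lemma head_symbol_range:
  assumes "set S \<subseteq> D" "set T \<subseteq> D"
  shows "head_symbol S T h p \<in> insert None (Some ` D)"
proof -
  have "set (stream_of S T s) \<subseteq> D" for s using assms by (cases s) auto
  then show ?thesis
    by (cases h) (auto simp: Let_def intro!: imageI subsetD[OF _ nth_mem])
qed

lemma config_at_Suc:
  "config_at kf kb A S T (Suc t) = step kf kb A S T (config_at kf kb A S T t)"
  by (simp add: config_at_def)

lemma step_in_configs:
  assumes "mp2s_automaton D m kf kb A" "set S \<subseteq> D" "set T \<subseteq> D"
    and "length S = n" "length T = n"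
    and "c \<in> states A \<times> (heads kf kb \<rightarrow>\<^sub>E {..n})"
  shows "step kf kb A S T c \<in> states A \<times> (heads kf kb \<rightarrow>\<^sub>E {..n})"
    and "h \<in> heads kf kb \<Longrightarrow> snd c h \<le> snd (step kf kb A S T c) h"
proof -
  obtain q pos where c: "c = (q, pos)" by (cases c)
  have len: "length (stream_of S T s) = n" for s using assms(4,5) by (cases s) auto
  obtain q' mv where tr: "trans_fun A (q, \<lambda>h\<in>heads kf kb. head_symbol S T h (pos h)) = (q', mv)"
    by fastforce
  \<comment> \<open>\<open>trans_fun\<close> is constrained only on this domain, which is why both
    streams must be over \<open>D\<close>.\<close>
  have "(q, \<lambda>h\<in>heads kf kb. head_symbol S T h (pos h)) \<in>
      states A \<times> (heads kf kb \<rightarrow>\<^sub>E insert None (Some ` D))"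
    using assms(6) head_symbol_range[OF assms(2,3)] unfolding c by auto
  then have q': "q' \<in> states A"
    using assms(1) tr unfolding mp2s_automaton_def by (metis (no_types, lifting) Pi_iff mem_Sigma_iff)
  have pos: "pos h \<le> n" if "h \<in> heads kf kb" for h
    using assms(6) that unfolding c by auto
  show "step kf kb A S T c \<in> states A \<times> (heads kf kb \<rightarrow>\<^sub>E {..n})"
    using q' pos by (auto simp: c step_def tr len split: move.split)
  show "snd c h \<le> snd (step kf kb A S T c) h" if "h \<in> heads kf kb"
    using pos that by (auto simp: c step_def tr len split: move.split)
qed

lemma config_at_in_configs:
  assumes "mp2s_automaton D m kf kb A" "set S \<subseteq> D" "set T \<subseteq> D"
    and "length S = n" "length T = n"
  shows "config_at kf kb A S T t \<in> states A \<times> (heads kf kb \<rightarrow>\<^sub>E {..n})"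
proof (induction t)
  case 0
  then show ?case
    using assms(1) by (auto simp: config_at_def initial_config_def mp2s_automaton_def)
next
  case (Suc t)
  then show ?case
    unfolding config_at_Suc by (rule step_in_configs(1)[OF assms])
qed

lemma position_mono:
  assumes "mp2s_automaton D m kf kb A" "set S \<subseteq> D" "set T \<subseteq> D"
    and "length S = n" "length T = n" and "h \<in> heads kf kb" and "t \<le> t'"
  shows "snd (config_at kf kb A S T t) h \<le> snd (config_at kf kb A S T t') h"
  using assms(7)
proof (induction t' rule: dec_induct)
  case (step t')
  have "snd (config_at kf kb A S T t') h \<le> snd (config_at kf kb A S T (Suc t')) h"
    unfolding config_at_Suc
    using step_in_configs(2)[OF assms(1-5) config_at_in_configs[OF assms(1-5)] assms(6)] .
  then show ?case using step.IH by simp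
qed simp

section \<open>Forward heads and the input words with their blocks\<close>

lemma heads_forward:
  "heads kf 0 = Forward StreamS ` {..<kf} \<union> Forward StreamT ` {..<kf}"
  by (auto simp: heads_def) (metis (full_types) image_eqI lessThan_iff stream_id.exhaust)

lemma finite_heads_forward: "finite (heads kf 0)"
  by (simp add: heads_forward)

lemma card_heads_forward: "card (heads kf 0) = 2 * kf"
  unfolding heads_forward
  by (subst card_Un_disjoint) (auto simp: card_image inj_on_def)

text \<open>Applied to the complement of a set this yields the other item of each pair;
  \<open>Suc\<close> shifts list indices to the item numbering from 1.\<close>

definition item_at :: "nat set \<Rightarrow> nat \<Rightarrow> item" where
  "item_at I i = (if i \<in> I then ItemA (Suc i) else ItemB (Suc i))"

lemma item_at_in_data_items: "i < n \<Longrightarrow> item_at I i \<in> data_items n"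
  by (auto simp: item_at_def data_items_def)

lemma item_at_eq_iff: "item_at I i = item_at J i' \<longleftrightarrow> i = i' \<and> (i \<in> I \<longleftrightarrow> i \<in> J)"
  by (auto simp: item_at_def)

locale disj_solver =
  fixes n m kf v L :: nat and A :: "('q, item) mp2s"
  assumes aut: "mp2s_automaton (data_items n) m kf 0 A"
    and solves: "solves_Disj n kf 0 A"
    and L_pos: "L > 0" and blocks_le: "v * L \<le> n" and v_gt: "kf\<^sup>2 < v"
begin

abbreviation H :: "head set" where "H \<equiv> heads kf 0"

text \<open>Positions from \<open>v * L\<close> on belong to no block and stay fixed. The map is an
  involution, so it translates positions on the second stream to indices and back.\<close>

definition rev_blocks :: "nat \<Rightarrow> nat" where
  "rev_blocks p = (if p < v * L then (v - 1 - p div L) * L + p mod L else p)"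

definition s_word :: "nat set \<Rightarrow> item list" where
  "s_word I = map (item_at I) [0..<n]"

definition t_word :: "nat set \<Rightarrow> item list" where
  "t_word J = map (\<lambda>p. item_at (- J) (rev_blocks p)) [0..<n]"

text \<open>Here \<open>j\<close> numbers a block of indices; on the second stream these indices sit
  in the mirrored block of positions.\<close>

fun block_start :: "nat \<Rightarrow> stream_id \<Rightarrow> nat" where
  "block_start j StreamS = j * L"
| "block_start j StreamT = (v - 1 - j) * L"

definition in_block :: "nat \<Rightarrow> 'q config \<Rightarrow> head \<Rightarrow> bool" where
  "in_block j c h \<longleftrightarrow>
     block_start j (head_stream h) \<le> snd c h \<and> snd c h < block_start j (head_stream h) + L"

definition run :: "nat set \<Rightarrow> nat set \<Rightarrow> nat \<Rightarrow> 'q config" where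
  "run I J = config_at kf 0 A (s_word I) (t_word J)"

definition passed :: "'q config \<Rightarrow> bool" where
  "passed c \<longleftrightarrow> (\<forall>h\<in>H. snd c h = n)"

text \<open>The \<open>LEAST\<close> is attained whenever the run of \<open>I\<close> passes both
  streams, because no block \<open>j < v\<close> extends beyond \<open>n\<close>.\<close>

definition leave_time :: "nat set \<Rightarrow> nat \<Rightarrow> head \<Rightarrow> nat" where
  "leave_time I j h = (LEAST t. block_start j (head_stream h) + L \<le> snd (run I I t) h)"

definition uncompared :: "nat set \<Rightarrow> nat \<Rightarrow> bool" where
  "uncompared I j \<longleftrightarrow> (\<forall>t. \<forall>i<kf. \<forall>i'<kf.
     \<not> (in_block j (run I I t) (Forward StreamS i) \<and> in_block j (run I I t) (Forward StreamT i')))"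

section \<open>Block reversal and disjointness of the input words\<close>

lemma rev_blocks_less:
  assumes "p < v * L"
  shows "rev_blocks p < v * L"
proof -
  have "p div L < v" using assms by (simp add: less_mult_imp_div_less)
  then have "Suc (v - 1 - p div L) * L \<le> v * L" by (intro mult_right_mono) auto
  moreover have "p mod L < L" using L_pos by simp
  ultimately show ?thesis using assms by (simp add: rev_blocks_def)
qed

lemma rev_blocks_less_n: "p < n \<Longrightarrow> rev_blocks p < n"
  using rev_blocks_less[of p] blocks_le by (cases "p < v * L") (auto simp: rev_blocks_def)

lemma rev_blocks_rev_blocks: "rev_blocks (rev_blocks p) = p"
proof (cases "p < v * L")
  case True
  have d: "p div L < v" using True by (simp add: less_mult_imp_div_less)
  have r: "rev_blocks p = (v - 1 - p div L) * L + p mod L" using True by (simp add: rev_blocks_def)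
  have "rev_blocks p div L = v - 1 - p div L" "rev_blocks p mod L = p mod L"
    using L_pos unfolding r by auto
  moreover have "v - 1 - (v - 1 - p div L) = p div L" using d by simp
  ultimately show ?thesis using rev_blocks_less[OF True] by (simp add: rev_blocks_def[of "rev_blocks p"])
qed (simp add: rev_blocks_def)

text \<open>Reversing once more sends an index in block \<open>j\<close> back to a position in the
  mirrored block.\<close>

lemma rev_blocks_in_block:
  assumes "j < v" "rev_blocks p \<in> {j * L..<j * L + L}"
  shows "block_start j StreamT \<le> p \<and> p < block_start j StreamT + L"
proof -
  let ?r = "rev_blocks p"
  have d: "?r div L = j"
    using assms(2) L_pos by (intro div_nat_eqI) (auto simp: algebra_simps)
  have "Suc j * L \<le> v * L" using assms(1) by (intro mult_right_mono) auto
  then have "?r < v * L" using assms(2) by auto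
  then have "rev_blocks ?r = (v - 1 - j) * L + ?r mod L" using d by (simp add: rev_blocks_def)
  moreover have "?r mod L < L" using L_pos by simp
  ultimately show ?thesis unfolding rev_blocks_rev_blocks by simp
qed

lemma length_words [simp]: "length (s_word I) = n" "length (t_word I) = n"
  by (auto simp: s_word_def t_word_def)

lemma set_words: "set (s_word I) \<subseteq> data_items n" "set (t_word I) \<subseteq> data_items n"
  by (auto simp: s_word_def t_word_def intro!: item_at_in_data_items rev_blocks_less_n)

lemma words_disjoint_iff: "set (s_word I) \<inter> set (t_word J) = {} \<longleftrightarrow> (\<forall>i<n. i \<in> I \<longleftrightarrow> i \<in> J)"
proof
  assume disj: "set (s_word I) \<inter> set (t_word J) = {}"
  show "\<forall>i<n. i \<in> I \<longleftrightarrow> i \<in> J"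
  proof (intro allI impI, rule ccontr)
    fix i assume i: "i < n" "(i \<in> I) \<noteq> (i \<in> J)"
    have "item_at I i \<in> set (s_word I)" using i by (auto simp: s_word_def)
    \<comment> \<open>Position \<open>rev_blocks i\<close> of the second stream carries the item
      with index \<open>i\<close>.\<close>
    moreover have "item_at (- J) (rev_blocks (rev_blocks i)) \<in> set (t_word J)"
      using rev_blocks_less_n[OF i(1)] by (auto simp: t_word_def)
    moreover have "item_at (- J) (rev_blocks (rev_blocks i)) = item_at I i"
      using i by (auto simp: rev_blocks_rev_blocks item_at_eq_iff)
    ultimately show False using disj by auto
  qed
next
  assume "\<forall>i<n. i \<in> I \<longleftrightarrow> i \<in> J"
  then show "set (s_word I) \<inter> set (t_word J) = {}"
    by (auto simp: s_word_def t_word_def item_at_eq_iff)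
qed

section \<open>Pure and mixed runs\<close>

lemma run_Suc: "run I J (Suc t) = step kf 0 A (s_word I) (t_word J) (run I J t)"
  by (simp add: run_def config_at_Suc)

lemma run_0: "run I J 0 = run I' J' 0"
  by (simp add: run_def config_at_def)

lemma run_in_configs: "run I J t \<in> states A \<times> (H \<rightarrow>\<^sub>E {..n})"
  unfolding run_def by (rule config_at_in_configs[OF aut set_words length_words])

lemma run_mono: "h \<in> H \<Longrightarrow> t \<le> t' \<Longrightarrow> snd (run I J t) h \<le> snd (run I J t') h"
  unfolding run_def by (rule position_mono[OF aut set_words length_words])

lemma passed_mono:
  assumes "passed (run I J t)" "t \<le> t'"
  shows "passed (run I J t')"
  unfolding passed_def
proof
  fix h assume h: "h \<in> H"
  have "snd (run I J t') h \<le> n" using run_in_configs[of I J t'] h by (auto simp: mem_Times_iff)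
  then show "snd (run I J t') h = n"
    using run_mono[OF h assms(2), of I J] assms(1) h by (auto simp: passed_def)
qed

lemma all_passed_iff: "all_passed kf 0 (s_word I) (t_word J) c \<longleftrightarrow> passed c"
proof -
  have "length (stream_of (s_word I) (t_word J) s) = n" for s by (cases s) auto
  then show ?thesis by (simp add: all_passed_def passed_def)
qed

text \<open>The one place where correctness of the automaton enters. For \<open>I = J\<close> it
  says that every pure run terminates and accepts.\<close>

lemma run_accepting_iff:
  "(\<exists>t. passed (run I J t) \<and> (\<forall>t'<t. \<not> passed (run I J t')) \<and> fst (run I J t) \<in> accepting A)
    \<longleftrightarrow> (\<forall>i<n. i \<in> I \<longleftrightarrow> i \<in> J)"
proof -
  have "accepts kf 0 A (s_word I) (t_word J) \<longleftrightarrow> set (s_word I) \<inter> set (t_word J) = {}"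
    using solves set_words by (simp add: solves_Disj_def)
  then show ?thesis
    by (simp add: accepts_def all_passed_iff run_def words_disjoint_iff)
qed

section \<open>Leave times and uncompared blocks\<close>

lemma block_le: "j < v \<Longrightarrow> block_start j s + L \<le> n"
proof -
  assume j: "j < v"
  have "Suc j * L \<le> v * L" "Suc (v - 1 - j) * L \<le> v * L"
    using j by (intro mult_right_mono; simp)+
  then show ?thesis using blocks_le by (cases s) auto
qed

lemma leave_time_le:
  assumes "j < v" "h \<in> H" "passed (run I I t)"
  shows "leave_time I j h \<le> t"
  unfolding leave_time_def
  using assms block_le[OF assms(1)] by (intro Least_le) (auto simp: passed_def)

text \<open>Positions never decrease, so a head that is not yet beyond the block still has its leave
  time ahead. The time \<open>\<tau>\<close> witnesses that the \<open>LEAST\<close> is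
  attained.\<close>

lemma less_leave_time:
  assumes "j < v" "h \<in> H" "passed (run I I \<tau>)"
    and "snd (run I I t) h < block_start j (head_stream h) + L"
  shows "t < leave_time I j h"
proof (rule ccontr)
  assume "\<not> t < leave_time I j h"
  then have "snd (run I I (leave_time I j h)) h \<le> snd (run I I t) h"
    using run_mono[OF assms(2)] by simp
  moreover have "block_start j (head_stream h) + L \<le> snd (run I I (leave_time I j h)) h"
    unfolding leave_time_def
    by (rule LeastI[of _ \<tau>]) (use assms block_le[OF assms(1)] in \<open>auto simp: passed_def\<close>)
  ultimately show False using assms(4) by simp
qed

text \<open>The order of the blocks on the second stream is reversed, so two heads that move only
  forward can meet in at most one block.\<close>

lemma compared_block_unique:
  assumes "h \<in> H" "h' \<in> H" "head_stream h = StreamS" "head_stream h' = StreamT"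
    and "in_block j (run I I t) h" "in_block j (run I I t) h'"
    and "in_block j' (run I I t') h" "in_block j' (run I I t') h'"
    and "j' < v"
  shows "j' \<le> j"
proof (rule ccontr)
  assume "\<not> j' \<le> j"
  \<comment> \<open>For \<open>j < j'\<close> the head on the first stream forces
    \<open>t < t'\<close>, while the mirrored order on the second stream forces
    \<open>t' < t\<close>.\<close>
  then have j: "Suc j * L \<le> j' * L" "Suc (v - 1 - j') * L \<le> (v - 1 - j) * L"
    using assms(9) by (intro mult_right_mono; simp)+
  have "snd (run I I t) h < snd (run I I t') h"
    using assms(3,5,7) j(1) by (simp add: in_block_def)
  then have "t < t'" using run_mono[OF assms(1), of t' t I I] by force
  moreover have "snd (run I I t') h' < snd (run I I t) h'"
    using assms(4,6,8) j(2) by (simp add: in_block_def)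
  then have "t' < t" using run_mono[OF assms(2), of t t' I I] by force
  ultimately show False by simp
qed

text \<open>Each of the \<open>kf * kf\<close> pairs of heads accounts for at most one block, and
  there are more than that many blocks.\<close>

lemma exists_uncompared: "\<exists>j<v. uncompared I j"
proof (rule ccontr)
  assume no: "\<not> (\<exists>j<v. uncompared I j)"
  define C where "C = (\<lambda>(i, i'). {j. j < v \<and> (\<exists>t. in_block j (run I I t) (Forward StreamS i) \<and>
    in_block j (run I I t) (Forward StreamT i'))})"
  have cov: "{..<v} \<subseteq> (\<Union>p\<in>{..<kf} \<times> {..<kf}. C p)"
    using no unfolding uncompared_def C_def by auto blast
  have "card (C p) \<le> 1" if mem: "p \<in> {..<kf} \<times> {..<kf}" for p
  proof -
    obtain i i' where p: "p = (i, i')" "i < kf" "i' < kf" using mem by auto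
    have "j' \<le> j" if "j \<in> C p" "j' \<in> C p" for j j'
      using that compared_block_unique[of "Forward StreamS i" "Forward StreamT i'" j I _ j'] p
      unfolding C_def by (auto simp: heads_forward)
    then have "\<forall>x\<in>C p. \<forall>y\<in>C p. x = y" by (meson order.antisym)
    moreover have "finite (C p)" by (auto simp: C_def p)
    ultimately show ?thesis by (metis One_nat_def card_le_Suc0_iff_eq)
  qed
  then have "(\<Sum>p\<in>{..<kf} \<times> {..<kf}. card (C p)) \<le> (\<Sum>p\<in>{..<kf} \<times> {..<kf}. 1)"
    by (rule sum_mono)
  then have "(\<Sum>p\<in>{..<kf} \<times> {..<kf}. card (C p)) \<le> kf\<^sup>2"
    by (simp add: power2_eq_square)
  moreover have "card (\<Union>p\<in>{..<kf} \<times> {..<kf}. C p) \<le> (\<Sum>p\<in>{..<kf} \<times> {..<kf}. card (C p))"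
    by (rule card_UN_le) simp
  moreover have "card {..<v} \<le> card (\<Union>p\<in>{..<kf} \<times> {..<kf}. C p)"
    by (rule card_mono[OF _ cov]) (auto simp: C_def)
  ultimately show False using v_gt by simp
qed

section \<open>Simulation of a mixed run by two pure runs\<close>

text \<open>The second streams differ only inside block \<open>j\<close>, and no head on them is
  there to read the difference.\<close>

lemma step_eq_fst:
  assumes "\<And>i. i \<notin> {j * L..<j * L + L} \<Longrightarrow> i \<in> I \<longleftrightarrow> i \<in> J" and "j < v"
    and "\<And>i. i < kf \<Longrightarrow> \<not> in_block j c (Forward StreamT i)"
  shows "step kf 0 A (s_word I) (t_word J) c = step kf 0 A (s_word I) (t_word I) c"
proof (rule step_cong)
  fix h assume "h \<in> H"
  then consider i where "h = Forward StreamS i" | i where "h = Forward StreamT i" "i < kf"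
    by (auto simp: heads_forward)
  then show "head_symbol (s_word I) (t_word J) h (snd c h) = head_symbol (s_word I) (t_word I) h (snd c h)"
  proof cases
    case 2
    then have "rev_blocks (snd c h) \<notin> {j * L..<j * L + L}"
      using assms(3) rev_blocks_in_block[OF assms(2), of "snd c h"] by (auto simp: in_block_def)
    then show ?thesis using assms(1) 2 by (auto simp: t_word_def item_at_eq_iff)
  qed simp
qed simp_all

lemma step_eq_snd:
  assumes "\<And>i. i \<notin> {j * L..<j * L + L} \<Longrightarrow> i \<in> I \<longleftrightarrow> i \<in> J"
    and "\<And>i. i < kf \<Longrightarrow> \<not> in_block j c (Forward StreamS i)"
  shows "step kf 0 A (s_word I) (t_word J) c = step kf 0 A (s_word J) (t_word J) c"
proof (rule step_cong)
  fix h assume "h \<in> H"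
  then consider i where "h = Forward StreamT i" | i where "h = Forward StreamS i" "i < kf"
    by (auto simp: heads_forward)
  then show "head_symbol (s_word I) (t_word J) h (snd c h) = head_symbol (s_word J) (t_word J) h (snd c h)"
  proof cases
    case 2
    then have "snd c h \<notin> {j * L..<j * L + L}"
      using assms(2) by (auto simp: in_block_def)
    then show ?thesis using assms(1) 2 by (auto simp: s_word_def item_at_eq_iff)
  qed simp
qed simp_all

text \<open>If \<open>h\<close> stays in the block, the run of \<open>J\<close> can keep waiting. If
  \<open>h\<close> leaves, \<open>Suc t1\<close> is its leave time, and the equal configurations at
  leave times give a meeting point, even if other heads are still inside.\<close>

lemma follow_or_resync:
  assumes "j < v" and leave: "\<And>h. h \<in> H \<Longrightarrow> run I I (leave_time I j h) = run J J (leave_time J j h)"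
    and "passed (run I I \<tau>1)" "passed (run J J \<tau>2)" "t2 \<le> \<tau>2"
    and behind: "\<And>h. h \<in> H \<Longrightarrow> snd (run J J t2) h \<le> snd (run I I t1) h"
    and h: "h \<in> H" "head_stream h = s" "in_block j (run I I t1) h"
  shows "\<exists>t2'\<ge>t2. t2' \<le> \<tau>2 \<and> (run I I (Suc t1) = run J J t2' \<or>
     (\<exists>h\<in>H. head_stream h = s \<and> in_block j (run I I (Suc t1)) h) \<and>
     (\<forall>h\<in>H. snd (run J J t2') h \<le> snd (run I I (Suc t1)) h))"
proof (cases "in_block j (run I I (Suc t1)) h")
  case True
  have "snd (run J J t2) h \<le> snd (run I I (Suc t1)) h" if "h \<in> H" for h
    using behind[OF that] run_mono[OF that, of t1 "Suc t1" I I] by simp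
  then show ?thesis using True h assms(5) by blast
next
  case False
  have "snd (run I I t1) h \<le> snd (run I I (Suc t1)) h" using run_mono[OF h(1)] by simp
  then have out: "block_start j (head_stream h) + L \<le> snd (run I I (Suc t1)) h"
    using False h by (auto simp: in_block_def)
  have "leave_time I j h \<le> Suc t1"
    unfolding leave_time_def using out by (rule Least_le)
  moreover have "t1 < leave_time I j h"
    using less_leave_time[OF assms(1) h(1) assms(3)] h(3) by (simp add: in_block_def)
  ultimately have "leave_time I j h = Suc t1" by simp
  \<comment> \<open>At \<open>t2\<close> the head \<open>h\<close> is no further than in the
    followed run, hence not yet beyond the block; so the meeting point lies ahead of the waiting
    run.\<close>
  moreover have "t2 < leave_time J j h"
    using less_leave_time[OF assms(1) h(1) assms(4)] h behind[OF h(1)] by (simp add: in_block_def)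
  moreover have "leave_time J j h \<le> \<tau>2" using leave_time_le[OF assms(1) h(1) assms(4)] .
  ultimately show ?thesis using leave[OF h(1)] by (metis less_imp_le)
qed

text \<open>The combined run is in step with both pure runs, or follows one of them through the block
  while the other one waits at a time at which its heads are not further than those of \<open>c\<close>. The
  latter ensures that the runs meet at a later time of the waiting run, so \<open>t1 + t2\<close>
  grows with every step.\<close>

definition tracks :: "nat \<Rightarrow> nat set \<Rightarrow> nat set \<Rightarrow> 'q config \<Rightarrow> nat \<Rightarrow> nat \<Rightarrow> bool" where
  "tracks j I J c t1 t2 \<longleftrightarrow>
     (c = run I I t1 \<and> c = run J J t2) \<or>
     (c = run I I t1 \<and> (\<exists>h\<in>H. head_stream h = StreamS \<and> in_block j c h) \<and>
       (\<forall>h\<in>H. snd (run J J t2) h \<le> snd c h)) \<or>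
     (c = run J J t2 \<and> (\<exists>h\<in>H. head_stream h = StreamT \<and> in_block j c h) \<and>
       (\<forall>h\<in>H. snd (run I I t1) h \<le> snd c h))"

text \<open>A head in block \<open>j\<close> on one stream excludes heads in it on the other, so the
  mixed step is a step of the followed pure run.\<close>

lemma tracks_step:
  assumes j: "j < v" "uncompared I j" "uncompared J j"
    and agree: "\<And>i. i \<notin> {j * L..<j * L + L} \<Longrightarrow> i \<in> I \<longleftrightarrow> i \<in> J"
    and leave: "\<And>h. h \<in> H \<Longrightarrow> run I I (leave_time I j h) = run J J (leave_time J j h)"
    and \<tau>: "passed (run I I \<tau>1)" "passed (run J J \<tau>2)"
    and t: "t1 \<le> \<tau>1" "t2 \<le> \<tau>2" "tracks j I J c t1 t2" "\<not> passed c"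
  shows "\<exists>t1' t2'. t1' \<le> \<tau>1 \<and> t2' \<le> \<tau>2 \<and> t1 + t2 < t1' + t2' \<and>
    tracks j I J (step kf 0 A (s_word I) (t_word J) c) t1' t2'"
proof -
  let ?c' = "step kf 0 A (s_word I) (t_word J) c"
  have le_n: "snd (run K K u) h \<le> n" if "h \<in> H" for K u h
    using run_in_configs[of K K u] that by (auto simp: mem_Times_iff)
  \<comment> \<open>A waiting run cannot have finished: its positions are bounded by those of
    \<open>c\<close>, and \<open>c\<close> has not passed.\<close>
  have ahead: "\<not> passed (run K K u)" if "\<forall>h\<in>H. snd (run K K u) h \<le> snd c h" 
      and "c = run I I t1 \<or> c = run J J t2" for K u
    using that t(4) le_n unfolding passed_def by (metis order.antisym)
  have "\<not> passed (run I I t1)" "\<not> passed (run J J t2)"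
    using t(3,4) ahead unfolding tracks_def by auto
  then have lt: "t1 < \<tau>1" "t2 < \<tau>2"
    using \<tau> t(1,2) passed_mono by (metis le_neq_implies_less)+
  \<comment> \<open>When both runs coincide, a head inside the block decides which run is followed
    next; \<open>N\<close> remains for an empty block.\<close>
  consider
    (S) "c = run I I t1" "\<exists>h\<in>H. head_stream h = StreamS \<and> in_block j c h"
       "\<forall>h\<in>H. snd (run J J t2) h \<le> snd c h"
  | (T) "c = run J J t2" "\<exists>h\<in>H. head_stream h = StreamT \<and> in_block j c h"
       "\<forall>h\<in>H. snd (run I I t1) h \<le> snd c h"
  | (N) "c = run I I t1" "c = run J J t2" "\<forall>h\<in>H. \<not> in_block j c h"
  proof (cases "c = run I I t1 \<and> c = run J J t2")
    case True
    note eq = True[THEN conjunct1, symmetric] True[THEN conjunct2, symmetric]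
    show ?thesis
    proof (cases "\<exists>h\<in>H. in_block j c h")
      case in_some: True
      then obtain h where h: "h \<in> H" "in_block j c h" by blast
      show ?thesis
      proof (cases "head_stream h")
        case StreamS
        then have "\<exists>h\<in>H. head_stream h = StreamS \<and> in_block j c h" using h by blast
        with S[unfolded eq] show ?thesis by simp
      next
        case StreamT
        then have "\<exists>h\<in>H. head_stream h = StreamT \<and> in_block j c h" using h by blast
        with T[unfolded eq] show ?thesis by simp
      qed
    next
      case False
      with N[unfolded eq] show ?thesis by blast
    qed
  next
    case False
    with t(3) S T show ?thesis unfolding tracks_def by argo
  qed
  then show ?thesis
  proof cases
    case S
    then obtain h where h: "h \<in> H" "head_stream h = StreamS" "in_block j c h" by blast
    have "\<not> in_block j c (Forward StreamT i)" if "i < kf" for i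
      using j(2) h S(1) that by (auto simp: uncompared_def heads_forward)
    then have c': "?c' = run I I (Suc t1)"
      using step_eq_fst[of j I J c, OF agree j(1)] S(1) by (simp add: run_Suc)
    obtain t2' where "t2 \<le> t2'" "t2' \<le> \<tau>2" "run I I (Suc t1) = run J J t2' \<or>
        (\<exists>h\<in>H. head_stream h = StreamS \<and> in_block j (run I I (Suc t1)) h) \<and>
        (\<forall>h\<in>H. snd (run J J t2') h \<le> snd (run I I (Suc t1)) h)"
      using follow_or_resync[OF j(1) leave \<tau> t(2), where ?t1.0 = t1] S h by blast
    then have "Suc t1 \<le> \<tau>1 \<and> t2' \<le> \<tau>2 \<and> t1 + t2 < Suc t1 + t2' \<and> tracks j I J ?c' (Suc t1) t2'"
      using lt unfolding tracks_def c' by auto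
    then show ?thesis by blast
  next
    case T
    then obtain h where h: "h \<in> H" "head_stream h = StreamT" "in_block j c h" by blast
    have "\<not> in_block j c (Forward StreamS i)" if "i < kf" for i
      using j(3) h T(1) that by (auto simp: uncompared_def heads_forward)
    then have c': "?c' = run J J (Suc t2)"
      using step_eq_snd[of j I J c, OF agree] T(1) by (simp add: run_Suc)
    obtain t1' where "t1 \<le> t1'" "t1' \<le> \<tau>1" "run J J (Suc t2) = run I I t1' \<or>
        (\<exists>h\<in>H. head_stream h = StreamT \<and> in_block j (run J J (Suc t2)) h) \<and>
        (\<forall>h\<in>H. snd (run I I t1') h \<le> snd (run J J (Suc t2)) h)"
      \<comment> \<open>The roles of \<open>I\<close> and \<open>J\<close> are exchanged: the run of
        \<open>J\<close> is now the followed one.\<close>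
      using follow_or_resync[OF j(1) leave[symmetric] \<tau>(2,1) t(1), where ?t1.0 = t2] T h by blast
    then have "t1' \<le> \<tau>1 \<and> Suc t2 \<le> \<tau>2 \<and> t1 + t2 < t1' + Suc t2 \<and> tracks j I J ?c' t1' (Suc t2)"
      using lt unfolding tracks_def c' by auto
    then show ?thesis by blast
  next
    case N
    have "?c' = run I I (Suc t1)"
      using step_eq_fst[of j I J c, OF agree j(1)] N by (simp add: run_Suc heads_forward)
    moreover have "?c' = run J J (Suc t2)"
      using step_eq_snd[of j I J c, OF agree] N by (simp add: run_Suc heads_forward)
    ultimately have "Suc t1 \<le> \<tau>1 \<and> Suc t2 \<le> \<tau>2 \<and> t1 + t2 < Suc t1 + Suc t2 \<and>
        tracks j I J ?c' (Suc t1) (Suc t2)"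
      using lt unfolding tracks_def by auto
    then show ?thesis by blast
  qed
qed

text \<open>Bounded tracked times make the mixed run terminate, in the accepting state of a pure
  run. Correctness then makes the mixed streams disjoint, which forces agreement.\<close>

lemma indistinguishable_imp_eq:
  assumes j: "j < v" "uncompared I j" "uncompared J j"
    and agree: "\<And>i. i \<notin> {j * L..<j * L + L} \<Longrightarrow> i \<in> I \<longleftrightarrow> i \<in> J"
    and leave: "\<And>h. h \<in> H \<Longrightarrow> run I I (leave_time I j h) = run J J (leave_time J j h)"
    and "i < n"
  shows "i \<in> I \<longleftrightarrow> i \<in> J"
proof -
  obtain \<tau>1 where \<tau>1: "passed (run I I \<tau>1)" "\<forall>t<\<tau>1. \<not> passed (run I I t)"
      "fst (run I I \<tau>1) \<in> accepting A"
    using run_accepting_iff[of I I] by blast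
  obtain \<tau>2 where \<tau>2: "passed (run J J \<tau>2)" "\<forall>t<\<tau>2. \<not> passed (run J J t)"
      "fst (run J J \<tau>2) \<in> accepting A"
    using run_accepting_iff[of J J] by blast
  have inv: "\<exists>t1 t2. t1 \<le> \<tau>1 \<and> t2 \<le> \<tau>2 \<and> t \<le> t1 + t2 \<and> tracks j I J (run I J t) t1 t2"
    if "\<forall>t'<t. \<not> passed (run I J t')" for t
    using that
  proof (induction t)
    case 0
    have "tracks j I J (run I J 0) 0 0" using run_0 unfolding tracks_def by blast
    then show ?case by blast
  next
    case (Suc t)
    then obtain t1 t2 where t: "t1 \<le> \<tau>1" "t2 \<le> \<tau>2" "t \<le> t1 + t2" "tracks j I J (run I J t) t1 t2"
      by auto
    then obtain t1' t2' where "t1' \<le> \<tau>1" "t2' \<le> \<tau>2" "t1 + t2 < t1' + t2'"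
        "tracks j I J (run I J (Suc t)) t1' t2'"
      using tracks_step[OF j agree leave \<tau>1(1) \<tau>2(1) t(1,2,4)] Suc.prems by (auto simp: run_Suc)
    then show ?case using t(3) by (meson Suc_leI le_less_trans)
  qed
  have "\<exists>t. passed (run I J t)"
  proof (rule ccontr)
    assume "\<nexists>t. passed (run I J t)"
    \<comment> \<open>The sum of the tracked times would exceed its bound
      \<open>\<tau>1 + \<tau>2\<close>.\<close>
    then show False using inv[of "\<tau>1 + \<tau>2 + 1"] by fastforce
  qed
  then obtain t where t: "passed (run I J t)" "\<forall>t'<t. \<not> passed (run I J t')"
    using exists_least_iff[of "\<lambda>t. passed (run I J t)"] by blast
  obtain t1 t2 where t12: "t1 \<le> \<tau>1" "t2 \<le> \<tau>2" "tracks j I J (run I J t) t1 t2"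
    using inv[OF t(2)] by blast
  then consider "run I J t = run I I t1" | "run I J t = run J J t2" unfolding tracks_def by blast
  then have "fst (run I J t) \<in> accepting A"
  proof cases
    case 1
    \<comment> \<open>All heads have passed at \<open>t1\<close>, whereas \<open>\<tau>1\<close> is
      the first such time.\<close>
    then have "t1 = \<tau>1" using t(1) t12(1) \<tau>1(2) by (metis le_neq_implies_less)
    then show ?thesis using 1 \<tau>1(3) by simp
  next
    case 2
    then have "t2 = \<tau>2" using t(1) t12(2) \<tau>2(2) by (metis le_neq_implies_less)
    then show ?thesis using 2 \<tau>2(3) by simp
  qed
  then show ?thesis using run_accepting_iff[of I J] t \<open>i < n\<close> by blast
qed

section \<open>Counting argument\<close>

text \<open>There are \<open>v\<close> choices of a block, \<open>2 ^ (n - L)\<close> sets outside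
  it and \<open>m * (n + 1) ^ (2 * kf)\<close> configurations for each of the \<open>2 * kf\<close>
  heads. Fewer such keys than the \<open>2 ^ n\<close> sets would leave two distinct sets
  indistinguishable.\<close>

lemma two_power_block_length_le: "2 ^ L \<le> v * (m * (n + 1) ^ (2 * kf)) ^ (2 * kf)"
proof (rule ccontr)
  let ?M = "(m * (n + 1) ^ (2 * kf)) ^ (2 * kf)"
  assume "\<not> 2 ^ L \<le> v * ?M"
  then have lt: "v * ?M < 2 ^ L" by simp
  define B where "B j = {j * L..<j * L + L}" for j
  define Tr where "Tr = (H \<rightarrow>\<^sub>E states A \<times> (H \<rightarrow>\<^sub>E {..n}))"
  define R where "R = (SIGMA j:{..<v}. Pow ({..<n} - B j) \<times> Tr)"
  obtain blk where blk: "\<And>I. blk I < v" "\<And>I. uncompared I (blk I)"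
    using exists_uncompared by metis
  define key where "key I = (blk I, I - B (blk I), \<lambda>h\<in>H. run I I (leave_time I (blk I) h))" for I
  have fin: "finite (states A)" "card (states A) = m" using aut by (auto simp: mp2s_automaton_def)
  have cardTr: "card Tr = ?M"
    using fin by (simp add: Tr_def card_PiE finite_heads_forward card_heads_forward card_cartesian_product)
  have finTr: "finite Tr"
    unfolding Tr_def using fin finite_heads_forward by (intro finite_PiE finite_cartesian_product) auto
  have cardB: "card (Pow ({..<n} - B j)) = 2 ^ (n - L)" if "j < v" for j
  proof -
    have "B j \<subseteq> {..<n}" using block_le[OF that, of StreamS] by (auto simp: B_def)
    then have "card ({..<n} - B j) = n - L" by (subst card_Diff_subset) (auto simp: B_def)
    then show ?thesis by (simp add: card_Pow)
  qed
  have finR: "finite R" unfolding R_def using finTr by (intro finite_SigmaI) auto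
  have "key ` Pow {..<n} \<subseteq> R"
    using blk run_in_configs by (auto simp: key_def R_def Tr_def)
  then have "card (key ` Pow {..<n}) \<le> card R" by (rule card_mono[OF finR])
  also have "card R = (\<Sum>j<v. 2 ^ (n - L) * ?M)"
    unfolding R_def using finTr
    by (subst card_SigmaI) (auto simp: card_cartesian_product cardB cardTr)
  also have "\<dots> = (v * ?M) * 2 ^ (n - L)" by simp
  also have "\<dots> < 2 ^ L * 2 ^ (n - L)" using lt by (intro mult_strict_right_mono) auto
  also have "\<dots> = 2 ^ n"
    \<comment> \<open>Any set may stand for \<open>undefined\<close>: the fact supplies
      \<open>L \<le> n\<close>, so that \<open>n - L\<close> is not truncated.\<close>
    using block_le[OF blk(1), of undefined StreamS] by (simp flip: power_add)
  also have "\<dots> = card (Pow {..<n})" by (simp add: card_Pow)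
  finally obtain I J where IJ: "I \<subseteq> {..<n}" "J \<subseteq> {..<n}" "key I = key J" "I \<noteq> J"
    using pigeonhole[of key "Pow {..<n}"] unfolding inj_on_def by auto
  have b: "blk J = blk I" using IJ(3) by (simp add: key_def)
  have outside: "I - B (blk I) = J - B (blk I)"
    and tr: "(\<lambda>h\<in>H. run I I (leave_time I (blk I) h)) = (\<lambda>h\<in>H. run J J (leave_time J (blk I) h))"
    using IJ(3) unfolding key_def b prod.inject by blast+
  have "i \<in> I \<longleftrightarrow> i \<in> J" if "i < n" for i
  proof (rule indistinguishable_imp_eq[OF blk(1)[of I] blk(2)[of I] _ _ _ that])
    show "uncompared J (blk I)" using blk(2)[of J] b by simp
    show "i \<in> I \<longleftrightarrow> i \<in> J" if "i \<notin> {blk I * L..<blk I * L + L}" for i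
      using outside that unfolding B_def by blast
    show "run I I (leave_time I (blk I) h) = run J J (leave_time J (blk I) h)" if "h \<in> H" for h
      using fun_cong[OF tr, of h] that by simp
  qed
  then show False using IJ by blast
qed

end

section \<open>Passage from the counting bound to logarithms\<close>

theorem theorem4p3:
  fixes n m kf k v :: nat
  assumes "n \<ge> 1" and "m \<ge> 1"
    and "k = 2 * kf" and "v = kf\<^sup>2 + 1"
    and "(real k)\<^sup>2 * real v * log 2 (real n + 1) + real k * real v * log 2 (real m)
           + real v * (1 + log 2 (real v)) \<le> real n"
  shows "\<not> (\<exists>A :: ('q, item) mp2s. mp2s_automaton (data_items n) m kf 0 A \<and> solves_Disj n kf 0 A)"
proof
  assume "\<exists>A :: ('q, item) mp2s. mp2s_automaton (data_items n) m kf 0 A \<and> solves_Disj n kf 0 A"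
  then obtain A :: "('q, item) mp2s"
    where A: "mp2s_automaton (data_items n) m kf 0 A" "solves_Disj n kf 0 A" by blast
  define L where "L = n div v"
  define X where "X = (real k)\<^sup>2 * log 2 (real n + 1) + real k * log 2 (real m)"
  have v: "v > 0" using assms(4) by simp
  have "real v * (X + 1 + log 2 (real v)) \<le> real n"
    using assms(5) by (simp add: X_def algebra_simps)
  \<comment> \<open>Rounding in \<open>n div v\<close> loses less than one, which the summand 1 in
    \<open>1 + log 2 (real v)\<close> pays for.\<close>
  also have "n < v * (L + 1)"
    using v dividend_less_times_div[of v n] by (simp add: L_def)
  then have "real n < real v * (real L + 1)" by (metis of_nat_1 of_nat_add of_nat_less_iff of_nat_mult)
  finally have XL: "X + log 2 (real v) < real L" using v by simp
  \<comment> \<open>Nonnegativity turns \<open>XL\<close> into \<open>L > 0\<close>, which the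
    locale requires.\<close>
  have "X \<ge> 0" using assms(2) by (simp add: X_def)
  moreover have "log 2 (real v) \<ge> 0" using v by simp
  ultimately have "L > 0" using XL by linarith
  then interpret disj_solver n m kf v L A
    using A assms(4) times_div_less_eq_dividend[of v n]
    unfolding L_def[symmetric] by unfold_locales auto
  have "real (2 ^ L) \<le> real (v * (m * (n + 1) ^ k) ^ k)"
    using two_power_block_length_le assms(3) by (simp only: of_nat_le_iff)
  then have "log 2 (2 ^ L) \<le> log 2 (real v * (real m * (real n + 1) ^ k) ^ k)"
    by (intro log_mono) (auto simp: add.commute)
  also have "\<dots> = log 2 (real v) + real k * (log 2 (real m) + real k * log 2 (real n + 1))"
    using v assms(2) by (simp add: log_mult log_nat_power)
  also have "\<dots> = X + log 2 (real v)" by (simp add: X_def power2_eq_square algebra_simps)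
  finally show False using XL by simp
qed

end
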